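(* As $N\to\infty$, there exist $(r,t)$-Ruzsa–Szemerédi graphs on $N$ vertices with $$r = N^{1-o(1)} \qquad\text{and}\qquad rt = (1-o(1))\binom{N}{2}.$$ That is, there are functions $\eta_1(N),\eta_2(N)\to 0$ such that for every sufficiently large $N$ there exist positive integers $r,t$ and an $(r,t)$-Ruzsa–Szemerédi graph on $N$ vertices with $r\ge N^{1-\eta_1(N)}$ and $rt\ge (1-\eta_2(N))\binom N2$.
   Context: Graphs are finite, simple and undirected. An induced matching in a graph $G$ is a set of pairwise vertex-disjoint edges of $G$ such that the subgraph of $G$ induced on the set of endpoints of these edges contains no other edges. A graph $G=(V,E)$ is an $(r,t)$-Ruzsa–Szemerédi graph if $E$ is the union of $t$ pairwise (edge-)disjoint induced matchings of $G$, each of size exactly $r$ (so $|E|=rt$). *)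

theory Defs
  imports Complex_Main "HOL-Library.Disjoint_Sets"
begin

text \<open>A graph is given by its vertex set and its set of edges, an edge being a two-element
  set of vertices; loops, multiple edges and orientations are thereby excluded.\<close>

definition simple_graph :: "'a set \<Rightarrow> 'a set set \<Rightarrow> bool" where
  "simple_graph V E \<longleftrightarrow> finite V \<and> (\<forall>e\<in>E. e \<subseteq> V \<and> card e = 2)"

definition induced_edges :: "'a set set \<Rightarrow> 'a set \<Rightarrow> 'a set set" where
  "induced_edges E W = {e \<in> E. e \<subseteq> W}"

definition induced_matching :: "'a set set \<Rightarrow> 'a set set \<Rightarrow> bool" where
  "induced_matching E M \<longleftrightarrow> M \<subseteq> E \<and> disjoint M \<and> induced_edges E (\<Union>M) = M"

text \<open>The matchings are indexed, so that there are exactly \<open>t\<close> of them: for \<open>r > 0\<close>,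
  edge-disjointness forces the members of the family to be distinct.\<close>

definition ruzsa_szemeredi_graph :: "nat \<Rightarrow> nat \<Rightarrow> 'a set \<Rightarrow> 'a set set \<Rightarrow> bool" where
  "ruzsa_szemeredi_graph r t V E \<longleftrightarrow>
     simple_graph V E \<and>
     (\<exists>M :: nat \<Rightarrow> 'a set set.
        (\<forall>i<t. induced_matching E (M i) \<and> card (M i) = r) \<and>
        disjoint_family_on M {..<t} \<and>
        E = (\<Union>i<t. M i))"

lemma ruzsa_szemeredi_graph_card_edges:
  assumes "ruzsa_szemeredi_graph r t V E"
  shows "card E = r * t"
proof -
  from assms obtain M :: "nat \<Rightarrow> 'a set set" where
    V: "finite V" "E \<subseteq> Pow V"
    and M: "\<And>i. i < t \<Longrightarrow> M i \<subseteq> E \<and> card (M i) = r"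
    and disj: "disjoint_family_on M {..<t}" and E: "E = (\<Union>i<t. M i)"
    unfolding ruzsa_szemeredi_graph_def simple_graph_def induced_matching_def by blast
  from V have "finite E" by (meson finite_Pow_iff finite_subset)
  then have "\<And>i. i < t \<Longrightarrow> finite (M i)" using M by (meson finite_subset)
  then have "card E = (\<Sum>i<t. card (M i))"
    unfolding E using disj by (intro card_UN_disjoint) (auto simp: disjoint_family_on_def)
  then show ?thesis using M by (simp add: mult.commute)
qed

end

theory Submission
  imports Defs
begin

text \<open>Take the points of \<open>[C]\<^sup>n\<close> as vertices and join two of them when their squared distance is within
  \<open>n\<close> of its mean \<open>\<mu>\<close>; by Chebyshev only a fraction \<open>O(C\<^sup>4 / n)\<close> of the pairs is missing. Group the edges
  \<open>{x, y}\<close> by the sum \<open>x + y\<close>, for which there are fewer than \<open>(2 C)\<^sup>n\<close> values. If \<open>{x, y}\<close> and \<open>{x', y'}\<close>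
  lie in the same group and \<open>{x, x'}\<close> is an edge too, the parallelogram law forces
  \<open>|x' - y|\<^sup>2 \<le> 2 n\<close>, and only \<open>16\<^sup>n\<close> integer points are that close to \<open>y\<close>. Hence greedy colouring
  splits each group into \<open>O(16\<^sup>n)\<close> induced matchings, \<open>O((32 C)\<^sup>n)\<close> in total, which is
  \<open>N\<^bsup>1 + o(1)\<^esup>\<close> when \<open>C\<close> is large. Finally cut each matching into pieces of size exactly \<open>r\<close> and delete
  the fewer than \<open>r\<close> edges left over: deleting other edges keeps a matching induced.\<close>

subsection \<open>Colouring and cutting matchings\<close>

text \<open>Colours are assigned one element at a time: at most \<open>d\<close> of the
  \<open>d + 1\<close> colours \<open>0..d\<close> are blocked by elements coloured earlier.
  \<open>R\<close> may be reflexive, as the conflict relation on edges used later is.\<close>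

lemma greedy_coloring:
  assumes "finite A" and sym: "\<And>a b. R a b \<Longrightarrow> R b a"
    and "\<And>a. a \<in> A \<Longrightarrow> card {b \<in> A. R a b} \<le> d"
  shows "\<exists>f :: 'a \<Rightarrow> nat. (\<forall>a\<in>A. f a \<le> d) \<and> (\<forall>a\<in>A. \<forall>b\<in>A. a \<noteq> b \<longrightarrow> R a b \<longrightarrow> f a \<noteq> f b)"
  using assms(1,3)
proof (induction A)
  case (insert x A)
  have "card {b \<in> A. R a b} \<le> d" if "a \<in> A" for a
  proof -
    have "card {b \<in> A. R a b} \<le> card {b \<in> insert x A. R a b}"
      using insert.hyps by (intro card_mono) auto
    then show ?thesis using insert.prems[of a] that by simp
  qed
  then obtain f :: "'a \<Rightarrow> nat" where f: "\<And>a. a \<in> A \<Longrightarrow> f a \<le> d"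
    "\<And>a b. a \<in> A \<Longrightarrow> b \<in> A \<Longrightarrow> a \<noteq> b \<Longrightarrow> R a b \<Longrightarrow> f a \<noteq> f b"
    using insert.IH by blast
  have "card (f ` {b \<in> A. R x b}) \<le> card {b \<in> A. R x b}"
    using insert.hyps by (intro card_image_le) auto
  also have "\<dots> \<le> card {b \<in> insert x A. R x b}"
    using insert.hyps by (intro card_mono) auto
  also have "\<dots> \<le> d" using insert.prems by simp
  also have "d < card {..d}" by simp
  finally have "\<not> {..d} \<subseteq> f ` {b \<in> A. R x b}"
    using card_mono[of "f ` {b \<in> A. R x b}" "{..d}"] insert.hyps by auto
  then obtain c where c: "c \<le> d" "c \<notin> f ` {b \<in> A. R x b}" by auto
  show ?case
  proof (intro exI[of _ "f(x := c)"] conjI ballI impI)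
    fix a b assume "a \<in> insert x A" "b \<in> insert x A" "a \<noteq> b" "R a b"
    then show "(f(x := c)) a \<noteq> (f(x := c)) b"
      using f c sym[of a b] by (auto simp: image_iff)
  qed (use f c in auto)
qed auto

text \<open>An edge of \<open>E'\<close> inside \<open>\<Union>F\<close> belongs to \<open>M\<close>
  because \<open>M\<close> is induced. Being nonempty, it shares a vertex with some member of
  \<open>F\<close>, and disjointness of \<open>M\<close> makes the two equal.\<close>

lemma induced_matching_subset:
  assumes M: "induced_matching E M" and "{} \<notin> M" and "F \<subseteq> M" "F \<subseteq> E'" "E' \<subseteq> E"
  shows "induced_matching E' F"
proof -
  have disj: "disjoint M" and ind: "induced_edges E (\<Union>M) = M"
    using M by (auto simp: induced_matching_def)
  have "e \<in> F" if e: "e \<in> E'" "e \<subseteq> \<Union>F" for e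
  proof -
    have "e \<subseteq> \<Union>M" using e(2) \<open>F \<subseteq> M\<close> by blast
    then have "e \<in> induced_edges E (\<Union>M)"
      using e(1) \<open>E' \<subseteq> E\<close> by (auto simp: induced_edges_def)
    then have "e \<in> M" using ind by simp
    then obtain v where "v \<in> e" using \<open>{} \<notin> M\<close> by (metis equals0I)
    then obtain f where "f \<in> F" "v \<in> f" using e by blast
    then show ?thesis using \<open>e \<in> M\<close> \<open>v \<in> e\<close> disj \<open>F \<subseteq> M\<close> by (auto dest: disjointD)
  qed
  moreover have "disjoint F" using disj \<open>F \<subseteq> M\<close> by (meson pairwise_subset)
  ultimately show ?thesis
    using \<open>F \<subseteq> E'\<close> by (auto simp: induced_matching_def induced_edges_def)
qed

text \<open>Take a maximal family of disjoint \<open>r\<close>-element pieces, each inside one class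
  of \<open>\<kappa>\<close>. Maximality leaves at most \<open>r\<close> uncovered edges per class,
  and \<open>E'\<close> is the union of the pieces.\<close>

lemma ruzsa_szemeredi_subgraph:
  assumes G: "simple_graph V E" and "finite K" and K: "\<kappa> ` E \<subseteq> K"
    and ind: "\<And>k. k \<in> K \<Longrightarrow> induced_matching E {e \<in> E. \<kappa> e = k}" and "r > 0"
  obtains t E' where "ruzsa_szemeredi_graph r t V E'" "card E \<le> r * t + card K * r"
proof -
  have "finite V" and E: "\<And>e. e \<in> E \<Longrightarrow> e \<subseteq> V \<and> card e = 2"
    using G by (auto simp: simple_graph_def)
  have "E \<subseteq> Pow V" using E by blast
  then have finE: "finite E" using \<open>finite V\<close> finite_subset by blast
  define X where "X = {\<F>. \<F> \<subseteq> Pow E \<and> disjoint \<F> \<and>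
    (\<forall>F\<in>\<F>. card F = r \<and> (\<exists>k\<in>K. F \<subseteq> {e \<in> E. \<kappa> e = k}))}"
  have "finite X" using finE by (auto simp: X_def)
  moreover have "X \<noteq> {}" by (auto simp: X_def intro!: exI[of _ "{}"])
  ultimately obtain \<F> where \<F>: "\<F> \<in> X"
    and max: "\<forall>\<G>\<in>X. \<F> \<subseteq> \<G> \<longrightarrow> \<F> = \<G>"
    using finite_has_maximal[of X] by auto
  have \<F>sub: "\<F> \<subseteq> Pow E" and \<F>disj: "disjoint \<F>"
    and \<F>r: "\<And>F. F \<in> \<F> \<Longrightarrow> card F = r"
    and \<F>k: "\<And>F. F \<in> \<F> \<Longrightarrow> \<exists>k\<in>K. F \<subseteq> {e \<in> E. \<kappa> e = k}"
    using \<F> by (auto simp: X_def)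
  define E' where "E' = \<Union>\<F>"
  have "E' \<subseteq> E" using \<F>sub by (auto simp: E'_def)
  have "finite \<F>" using \<F>sub finE by (meson finite_Pow_iff finite_subset)
  then obtain M where M: "bij_betw M {..<card \<F>} \<F>"
    using ex_bij_betw_nat_finite by (metis atLeast0LessThan)
  have M\<F>: "M i \<in> \<F>" if "i < card \<F>" for i using M that by (auto simp: bij_betw_def)
  have "induced_matching E' F" if "F \<in> \<F>" for F
  proof -
    obtain k where k: "k \<in> K" "F \<subseteq> {e \<in> E. \<kappa> e = k}" using \<F>k \<open>F \<in> \<F>\<close> by blast
    moreover have "{} \<notin> E" using E by fastforce
    moreover have "F \<subseteq> E'" using that by (auto simp: E'_def)
    ultimately show ?thesis using induced_matching_subset[OF ind] \<open>E' \<subseteq> E\<close> by simp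
  qed
  moreover have "disjoint_family_on M {..<card \<F>}"
    using \<F>disj M
    by (intro disjoint_image_disjoint_family_on) (auto simp: bij_betw_def)
  moreover have "E' = (\<Union>i<card \<F>. M i)" using M by (auto simp: E'_def bij_betw_def)
  moreover have "simple_graph V E'" using G \<open>E' \<subseteq> E\<close> by (auto simp: simple_graph_def)
  ultimately have RS: "ruzsa_szemeredi_graph r (card \<F>) V E'"
    using M\<F> \<F>r unfolding ruzsa_szemeredi_graph_def by (intro conjI exI[of _ M]) auto
  have small: "card {e \<in> E - E'. \<kappa> e = k} \<le> r" if "k \<in> K" for k
  proof (rule ccontr)
    assume "\<not> ?thesis"
    \<comment> \<open>\<open>r\<close> uncovered edges of one class would form another piece. By
      maximality it is already in \<open>\<F>\<close>, yet it avoids \<open>\<Union>\<F>\<close>, so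
      it is empty, against \<open>r > 0\<close>.\<close>
    then obtain F where F: "F \<subseteq> {e \<in> E - E'. \<kappa> e = k}" "card F = r"
      by (meson nat_le_linear obtain_subset_with_card_n)
    then have "F \<inter> \<Union>\<F> = {}" by (auto simp: E'_def)
    then have "disjoint (insert F \<F>)" using \<F>disj by (auto simp: pairwise_insert disjnt_def)
    moreover have "F \<subseteq> {e \<in> E. \<kappa> e = k}" using F by blast
    ultimately have "insert F \<F> \<in> X" using F(2) \<F> that by (auto simp: X_def)
    then have "F \<in> \<F>" using max by auto
    then have "F = {}" using \<open>F \<inter> \<Union>\<F> = {}\<close> by blast
    then show False using F \<open>r > 0\<close> by simp
  qed
  have "card (E - E') \<le> card (\<Union>k\<in>K. {e \<in> E - E'. \<kappa> e = k})"
    using K finE \<open>finite K\<close> by (intro card_mono) auto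
  also have "\<dots> \<le> (\<Sum>k\<in>K. card {e \<in> E - E'. \<kappa> e = k})"
    using \<open>finite K\<close> by (rule card_UN_le)
  also have "\<dots> \<le> card K * r" using sum_bounded_above[of K _ r, OF small] by simp
  finally have "card E - card E' \<le> card K * r"
    using \<open>E' \<subseteq> E\<close> finE by (simp add: card_Diff_subset finite_subset)
  moreover have "card E' = r * card \<F>" using ruzsa_szemeredi_graph_card_edges[OF RS] .
  ultimately show thesis using that[OF RS] by simp
qed

subsection \<open>Counting points of the grid\<close>

lemma sum_half_power_le:
  assumes "finite S"
  shows "(\<Sum>k\<in>S. (1/2) ^ k) \<le> (2::real)"
proof -
  have "(\<Sum>k\<in>S. (1/2) ^ k) \<le> (\<Sum>k. (1/2::real) ^ k)"
    by (intro sum_le_suminf summable_geometric assms) auto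
  also have "\<dots> = 2" by (subst suminf_geometric) auto
  finally show ?thesis .
qed

text \<open>On each side of \<open>a\<close> the distances to \<open>a\<close> are distinct and at
  most their squares, so each side is bounded by a full geometric series. The bound does not depend
  on \<open>S\<close>, which keeps the size of the grid out of the ball count.\<close>

lemma sum_half_power_square_le:
  fixes S :: "int set"
  assumes "finite S"
  shows "(\<Sum>b\<in>S. (1/2) ^ nat ((a - b)\<^sup>2)) \<le> (4::real)"
proof -
  have half: "(\<Sum>b\<in>T. (1/2) ^ nat ((a - b)\<^sup>2)) \<le> (2::real)"
    if "finite T" "inj_on (\<lambda>b. nat \<bar>a - b\<bar>) T" for T
  proof -
    have "nat \<bar>a - b\<bar> \<le> nat ((a - b)\<^sup>2)" for b
    proof -
      have "\<bar>a - b\<bar> \<le> \<bar>a - b\<bar>\<^sup>2"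
        using self_le_power[of "\<bar>a - b\<bar>" 2] by (cases "a = b") auto
      then show ?thesis by (intro nat_mono) simp
    qed
    then have "(\<Sum>b\<in>T. (1/2) ^ nat ((a - b)\<^sup>2)) \<le> (\<Sum>b\<in>T. (1/2::real) ^ nat \<bar>a - b\<bar>)"
      by (intro sum_mono power_decreasing) auto
    also have "\<dots> = (\<Sum>k\<in>(\<lambda>b. nat \<bar>a - b\<bar>) ` T. (1/2) ^ k)"
      using that by (simp add: sum.reindex)
    also have "\<dots> \<le> 2" using that by (intro sum_half_power_le) auto
    finally show ?thesis .
  qed
  have "S = {b \<in> S. b \<le> a} \<union> {b \<in> S. b > a}" by auto
  then have "(\<Sum>b\<in>S. (1/2::real) ^ nat ((a - b)\<^sup>2)) =
      (\<Sum>b\<in>{b \<in> S. b \<le> a}. (1/2) ^ nat ((a - b)\<^sup>2)) + (\<Sum>b\<in>{b \<in> S. b > a}. (1/2) ^ nat ((a - b)\<^sup>2))"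
    using assms by (subst sum.union_disjoint[symmetric]) auto
  also have "\<dots> \<le> 2 + 2"
    using assms by (intro add_mono half) (auto simp: inj_on_def)
  finally show ?thesis by simp
qed

definition sqdist :: "nat \<Rightarrow> (nat \<Rightarrow> int) \<Rightarrow> (nat \<Rightarrow> int) \<Rightarrow> int" where
  "sqdist n x y = (\<Sum>k<n. (x k - y k)\<^sup>2)"

lemma sqdist_commute: "sqdist n x y = sqdist n y x"
  by (simp add: sqdist_def power2_commute)

text \<open>Markov's inequality for the weight \<open>2\<close> to the power \<open>- sqdist n x y\<close>, which factorises over
  the coordinates.\<close>
lemma card_ball_le:
  assumes "finite S"
  shows "card {y \<in> PiE {..<n} (\<lambda>_. S). sqdist n x y \<le> 2 * int n} \<le> 16 ^ n" (is "card ?B \<le> _")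
proof -
  have fin: "finite (PiE {..<n} (\<lambda>_. S))" using assms by (intro finite_PiE) auto
  \<comment> \<open>The factor 4 per coordinate offsets the least weight
    \<open>(1/2) ^ (2 * n)\<close> on the ball, so every point of it counts at least 1. The total
    over the grid is then at most \<open>(4 * 4) ^ n\<close>.\<close>
  have "1 \<le> (\<Prod>k<n. 4 * (1/2::real) ^ nat ((x k - y k)\<^sup>2))" if "y \<in> ?B" for y
  proof -
    have "int (\<Sum>k<n. nat ((x k - y k)\<^sup>2)) \<le> int (2 * n)"
      using that by (simp add: sqdist_def)
    then have "(\<Sum>k<n. nat ((x k - y k)\<^sup>2)) \<le> 2 * n" by linarith
    then have "(1/2) ^ (2 * n) \<le> (1/2::real) ^ (\<Sum>k<n. nat ((x k - y k)\<^sup>2))"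
      by (intro power_decreasing) auto
    also have "\<dots> = (\<Prod>k<n. (1/2) ^ nat ((x k - y k)\<^sup>2))"
      by (rule power_sum)
    finally have "4 ^ n * (1/2) ^ (2 * n) \<le> (\<Prod>k<n. 4 * (1/2::real) ^ nat ((x k - y k)\<^sup>2))"
      by (simp add: prod.distrib)
    moreover have "4 ^ n * (1/2::real) ^ (2 * n) = (4 * (1/2)\<^sup>2) ^ n"
      by (simp only: power_mult power_mult_distrib)
    ultimately show ?thesis by (simp add: power2_eq_square)
  qed
  then have "(\<Sum>y\<in>?B. 1) \<le> (\<Sum>y\<in>?B. \<Prod>k<n. 4 * (1/2::real) ^ nat ((x k - y k)\<^sup>2))"
    by (intro sum_mono)
  also have "\<dots> \<le> (\<Sum>y\<in>PiE {..<n} (\<lambda>_. S). \<Prod>k<n. 4 * (1/2::real) ^ nat ((x k - y k)\<^sup>2))"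
  proof (rule sum_mono2[OF fin])
    show "0 \<le> (\<Prod>k<n. 4 * (1/2::real) ^ nat ((x k - y k)\<^sup>2))" for y
      by (rule prod_nonneg) simp
  qed auto
  also have "\<dots> = (\<Prod>k<n. \<Sum>b\<in>S. 4 * (1/2::real) ^ nat ((x k - b)\<^sup>2))"
    using assms by (subst prod_sum_PiE) auto
  also have "\<dots> \<le> (\<Prod>k<n. 16)"
    using sum_half_power_square_le[OF assms]
    by (intro prod_mono) (auto intro!: sum_nonneg simp flip: sum_distrib_left)
  finally have "real (card ?B) \<le> 16 ^ n" by simp
  then show ?thesis by (simp flip: of_nat_le_iff)
qed

text \<open>Chebyshev's inequality for uniform points of \<open>B\<close> to the power
  \<open>n\<close>, in counting form: the coordinates are independent, so the sum has variance at
  most \<open>n * K\<^sup>2\<close>, compared with the squared threshold \<open>n\<^sup>2\<close>.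
  Keeping the factor \<open>n\<close> on the left avoids a division.\<close>

lemma chebyshev_PiE:
  fixes f :: "'b \<Rightarrow> real" and m K :: real
  assumes "finite B" "B \<noteq> {}" and avg: "m * card B = (\<Sum>b\<in>B. f b)"
    and dev: "\<And>b. b \<in> B \<Longrightarrow> \<bar>f b - m\<bar> \<le> K"
  shows "real n * card {w \<in> PiE {..<n} (\<lambda>_. B). \<bar>(\<Sum>k<n. f (w k)) - n * m\<bar> > n} \<le> K\<^sup>2 * real (card B) ^ n"
    (is "_ * real (card ?bad) \<le> _")
proof (cases "n = 0")
  case False
  define h where "h = (\<lambda>b. f b - m)"
  define P where "P = PiE {..<n} (\<lambda>_. B)"
  have finP: "finite P" using assms by (auto simp: P_def intro!: finite_PiE)
  have h0: "(\<Sum>b\<in>B. h b) = 0" using avg by (simp add: h_def sum_subtractf mult.commute)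
  have "K \<ge> 0" using dev \<open>B \<noteq> {}\<close> by (metis abs_ge_zero ex_in_conv order_trans)
  \<comment> \<open>The deviations of distinct coordinates are uncorrelated, so only the diagonal terms survive.\<close>
  have diag: "(\<Sum>w\<in>P. h (w k) * h (w l)) \<le> (if k = l then K\<^sup>2 * real (card B) ^ n else 0)"
    if "k < n" "l < n" for k l
  proof -
    \<comment> \<open>\<open>h (w k) * h (w l)\<close> written as a product over all coordinates,
      with factor 1 away from \<open>k\<close> and \<open>l\<close>, so that the sum over
      \<open>P\<close> factorises.\<close>
    define F where "F = (\<lambda>i b. (if i = k then h b else 1) * (if i = l then h b else 1))"
    have "(\<Sum>w\<in>P. h (w k) * h (w l)) = (\<Sum>w\<in>P. \<Prod>i<n. F i (w i))"
      using that by (simp add: F_def prod.distrib prod.delta)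
    also have "\<dots> = (\<Prod>i<n. \<Sum>b\<in>B. F i b)"
      unfolding P_def using assms by (subst prod_sum_PiE) auto
    also have "\<dots> \<le> (if k = l then K\<^sup>2 * real (card B) ^ n else 0)"
    proof (cases "k = l")
      case True
      have "(\<Sum>b\<in>B. (h b)\<^sup>2) \<le> card B * K\<^sup>2"
        using dev \<open>K \<ge> 0\<close> by (intro sum_bounded_above) (auto simp: h_def abs_le_square_iff[symmetric])
      moreover have "(\<Prod>i<n. \<Sum>b\<in>B. F i b) = (\<Sum>b\<in>B. F k b) * (\<Prod>i\<in>{..<n}-{k}. \<Sum>b\<in>B. F i b)"
        using that by (intro prod.remove) auto
      moreover have "(\<Prod>i\<in>{..<n}-{k}. \<Sum>b\<in>B. F i b) = real (card B) ^ (n - 1)"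
        using that True by (simp add: F_def)
      ultimately have "(\<Prod>i<n. \<Sum>b\<in>B. F i b) \<le> card B * K\<^sup>2 * real (card B) ^ (n - 1)"
        using True by (simp add: F_def power2_eq_square mult_right_mono)
      then show ?thesis using True False by (cases n) (auto simp: mult_ac)
    next
      case kl: False
      \<comment> \<open>The factor at coordinate \<open>k\<close> is the total deviation from the
        mean, which vanishes.\<close>
      have "(\<Sum>b\<in>B. F k b) = 0" using kl h0 by (simp add: F_def)
      then show ?thesis using that kl by (simp add: prod_zero[of "{..<n}"] bexI[of _ k])
    qed
    finally show ?thesis .
  qed
  have "(real n)\<^sup>2 * card ?bad = (\<Sum>w\<in>?bad. (real n)\<^sup>2)" by simp
  also have "\<dots> \<le> (\<Sum>w\<in>?bad. (\<Sum>k<n. h (w k))\<^sup>2)"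
    by (intro sum_mono) (auto simp: h_def sum_subtractf abs_le_square_iff[symmetric])
  also have "\<dots> \<le> (\<Sum>w\<in>P. (\<Sum>k<n. h (w k))\<^sup>2)"
    using finP by (intro sum_mono2) (auto simp: P_def)
  also have "\<dots> = (\<Sum>w\<in>P. \<Sum>k<n. \<Sum>l<n. h (w k) * h (w l))"
    by (simp add: power2_eq_square sum_product)
  also have "\<dots> = (\<Sum>k<n. \<Sum>l<n. \<Sum>w\<in>P. h (w k) * h (w l))"
    by (subst sum.swap, rule sum.cong[OF refl], subst sum.swap, rule refl)
  also have "\<dots> \<le> (\<Sum>k<n. \<Sum>l<n. if k = l then K\<^sup>2 * real (card B) ^ n else 0)"
    by (intro sum_mono diag) auto
  also have "\<dots> = real n * (K\<^sup>2 * real (card B) ^ n)" by simp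
  finally show ?thesis using False by (simp add: power2_eq_square mult.assoc)
qed (auto simp: assms)

subsection \<open>The distance graph\<close>

text \<open>Equal sums mean equal midpoints, so \<open>x y\<close> and \<open>x' y'\<close> are the
  diagonals of a parallelogram with adjacent sides \<open>x x'\<close> and
  \<open>x' y\<close>.\<close>

lemma sqdist_parallelogram:
  assumes "\<And>k. k < n \<Longrightarrow> x k + y k = x' k + y' k"
  shows "2 * (sqdist n x x' + sqdist n x' y) = sqdist n x y + sqdist n x' y'"
proof -
  have "2 * ((x k - x' k)\<^sup>2 + (x' k - y k)\<^sup>2) = (x k - y k)\<^sup>2 + (x' k - y' k)\<^sup>2" if "k < n" for k
  proof -
    have *: "y' k = x k + y k - x' k" using assms[OF that] by simp
    show ?thesis unfolding * by (simp add: power2_eq_square algebra_simps)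
  qed
  then show ?thesis by (simp add: sqdist_def sum_distrib_left flip: sum.distrib)
qed

text \<open>Vertices are labels placed in the grid by \<open>p\<close>, so that a vertex set of any
  size up to that of the grid can be used.\<close>

definition distance_graph :: "'a set \<Rightarrow> ('a \<Rightarrow> nat \<Rightarrow> int) \<Rightarrow> nat \<Rightarrow> real \<Rightarrow> 'a set set" where
  "distance_graph V p n \<mu> = {{i, j} |i j. i \<in> V \<and> j \<in> V \<and> i \<noteq> j \<and>
     \<bar>real_of_int (sqdist n (p i) (p j)) - \<mu>\<bar> \<le> real n}"

lemma distance_graph_pairD:
  assumes "{i, j} \<in> distance_graph V p n \<mu>"
  shows "\<bar>real_of_int (sqdist n (p i) (p j)) - \<mu>\<bar> \<le> real n"
  using assms sqdist_commute by (fastforce simp: distance_graph_def doubleton_eq_iff)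

lemma distance_graph_elemE:
  assumes "e \<in> distance_graph V p n \<mu>" "i \<in> e"
  obtains j where "e = {i, j}" "i \<noteq> j" "i \<in> V" "j \<in> V"
  using assms unfolding distance_graph_def by blast

lemma simple_graph_distance_graph:
  "finite V \<Longrightarrow> simple_graph V (distance_graph V p n \<mu>)"
  by (auto simp: simple_graph_def distance_graph_def)

text \<open>An edge is coloured by its coordinate sum together with a greedy colour that separates
  conflicting edges of equal sum. This works for every centre \<open>\<mu>\<close>, because
  \<open>\<mu>\<close> cancels in the parallelogram law.\<close>

lemma distance_graph_induced_matchings:
  fixes V :: "'a set" and p :: "'a \<Rightarrow> nat \<Rightarrow> int" and \<mu> :: real
  assumes "finite V" and inj: "inj_on p V" and p: "p ` V \<subseteq> PiE {..<n} (\<lambda>_. {0..<int C})"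
  defines "E \<equiv> distance_graph V p n \<mu>"
  obtains \<kappa> :: "'a set \<Rightarrow> (nat \<Rightarrow> int) \<times> nat" and K where "finite K" "\<kappa> ` E \<subseteq> K"
    "card K \<le> 3 * (32 * C) ^ n" "\<forall>k\<in>K. induced_matching E {e \<in> E. \<kappa> e = k}"
proof -
  define z where "z = (\<lambda>e. \<lambda>k\<in>{..<n}. \<Sum>i\<in>e. p i k)"
  have elemE: "\<exists>j. e = {i, j} \<and> i \<noteq> j \<and> i \<in> V \<and> j \<in> V" if "e \<in> E" "i \<in> e" for e i
    using distance_graph_elemE[OF that[unfolded E_def]] by metis
  have "simple_graph V E" unfolding E_def using \<open>finite V\<close> by (rule simple_graph_distance_graph)
  then have E: "e \<subseteq> V" "card e = 2" if "e \<in> E" for e using that by (auto simp: simple_graph_def)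
  have "E \<subseteq> Pow V" using E by blast
  then have finE: "finite E" using \<open>finite V\<close> finite_subset by blast
  have z_pair: "z {i, j} k = p i k + p j k" if "i \<noteq> j" "k < n" for i j k
    using that by (simp add: z_def)
  have p_range: "0 \<le> p i k \<and> p i k < int C" if "i \<in> V" "k < n" for i k
  proof -
    have "p i \<in> PiE {..<n} (\<lambda>_. {0..<int C})" using p that(1) by blast
    then have "p i k \<in> {0..<int C}" using that(2) by (rule PiE_mem[OF _ lessThan_iff[THEN iffD2]])
    then show ?thesis by simp
  qed
  \<comment> \<open>For a fixed sum, one endpoint determines the position of the other, and
    \<open>p\<close> is injective. This gives both the disjointness of classes and the injectivity
    in the degree count.\<close>
  have same_sum: "e = e'" if "e \<in> E" "e' \<in> E" "z e = z e'" "j \<in> e" "j \<in> e'" for e e' j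
  proof -
    obtain a where a: "e = {j, a}" "j \<noteq> a" "a \<in> V" using elemE \<open>e \<in> E\<close> \<open>j \<in> e\<close> by blast
    obtain b where b: "e' = {j, b}" "j \<noteq> b" "b \<in> V" using elemE \<open>e' \<in> E\<close> \<open>j \<in> e'\<close> by blast
    have "p a k = p b k" for k
    proof (cases "k < n")
      case True
      then show ?thesis using z_pair[of j a k] z_pair[of j b k] a b \<open>z e = z e'\<close> by simp
    next
      case False
      have "p a \<in> PiE {..<n} (\<lambda>_. {0..<int C})" "p b \<in> PiE {..<n} (\<lambda>_. {0..<int C})"
        using p a b by auto
      then show ?thesis using False by (auto simp: PiE_iff extensional_def)
    qed
    then have "p a = p b" by auto
    then show ?thesis using a b inj by (simp add: inj_on_eq_iff)
  qed
  define close where "close = (\<lambda>i j. sqdist n (p i) (p j) \<le> 2 * int n)"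
  define R where "R = (\<lambda>e e'. z e = z e' \<and> (\<exists>i\<in>e. \<exists>j\<in>e'. close i j))"
  have card_close: "card {j \<in> V. close i j} \<le> 16 ^ n" for i
  proof -
    have "card {j \<in> V. close i j}
        \<le> card {y \<in> PiE {..<n} (\<lambda>_. {0..<int C}). sqdist n (p i) y \<le> 2 * int n}"
    proof (rule card_inj_on_le[where f = p])
      show "inj_on p {j \<in> V. close i j}" using inj by (rule inj_on_subset) auto
      show "finite {y \<in> PiE {..<n} (\<lambda>_. {0..<int C}). sqdist n (p i) y \<le> 2 * int n}"
        by (rule finite_subset[OF _ finite_PiE[of "{..<n}" "\<lambda>_. {0..<int C}"]]) auto
    qed (use p in \<open>auto simp: close_def\<close>)
    also have "\<dots> \<le> 16 ^ n" by (rule card_ball_le) simp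
    finally show ?thesis .
  qed
  have degree: "card {e' \<in> E. R e e'} \<le> 2 * 16 ^ n" if "e \<in> E" for e
  proof -
    define N where "N = (\<lambda>i. {e' \<in> E. z e' = z e \<and> (\<exists>j\<in>e'. close i j)})"
    have N: "card (N i) \<le> 16 ^ n" for i
    proof -
      \<comment> \<open>Sending an edge to an endpoint close to \<open>i\<close> is injective within
        a sum class, so the ball count bounds \<open>N i\<close>. The two endpoints of
        \<open>e\<close> then give degree \<open>2 * 16 ^ n\<close>.\<close>
      define g where "g = (\<lambda>e'. SOME j. j \<in> e' \<and> close i j)"
      have g: "g e' \<in> e' \<and> close i (g e')" if "e' \<in> N i" for e'
        unfolding g_def by (rule someI_ex) (use that in \<open>auto simp: N_def\<close>)
      have "card (N i) \<le> card {j \<in> V. close i j}"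
      proof (rule card_inj_on_le[where f = g])
        show "inj_on g (N i)"
        proof (rule inj_onI)
          fix a b assume ab: "a \<in> N i" "b \<in> N i" "g a = g b"
          have "a \<in> E" "b \<in> E" "z a = z b" using ab by (auto simp: N_def)
          then show "a = b" using same_sum[of a b "g a"] g[OF ab(1)] g[OF ab(2)] ab(3) by simp
        qed
        show "g ` N i \<subseteq> {j \<in> V. close i j}"
        proof
          fix y assume "y \<in> g ` N i"
          then obtain e' where "e' \<in> N i" "y = g e'" by blast
          moreover from this have "e' \<subseteq> V" by (intro E) (simp add: N_def)
          ultimately show "y \<in> {j \<in> V. close i j}" using g by blast
        qed
      qed (use \<open>finite V\<close> in auto)
      then show ?thesis using card_close order_trans by blast
    qed
    have "finite e" using E[OF that] \<open>finite V\<close> finite_subset by blast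
    have "{e' \<in> E. R e e'} \<subseteq> (\<Union>i\<in>e. N i)" by (auto simp: R_def N_def)
    then have "card {e' \<in> E. R e e'} \<le> card (\<Union>i\<in>e. N i)"
      using \<open>finite e\<close> finE by (intro card_mono) (auto simp: N_def)
    also have "\<dots> \<le> (\<Sum>i\<in>e. card (N i))" using \<open>finite e\<close> by (rule card_UN_le)
    also have "\<dots> \<le> card e * 16 ^ n" using sum_bounded_above[of e "\<lambda>i. card (N i)" "16 ^ n"] N by simp
    finally show ?thesis using E[OF that] by simp
  qed
  have R_sym: "R e' e" if "R e e'" for e e'
    using that unfolding R_def close_def by (metis sqdist_commute)
  obtain f :: "'a set \<Rightarrow> nat" where f: "\<forall>e\<in>E. f e \<le> 2 * 16 ^ n"
    "\<forall>e\<in>E. \<forall>e'\<in>E. e \<noteq> e' \<longrightarrow> R e e' \<longrightarrow> f e \<noteq> f e'"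
    using greedy_coloring[where R = R, OF finE R_sym degree] by blast
  \<comment> \<open>Sums of two coordinates below \<open>C\<close> stay below \<open>2 * C\<close>;
    the greedy colours run from 0 to \<open>2 * 16 ^ n\<close> inclusive.\<close>
  define K where "K = PiE {..<n} (\<lambda>_. {0..<2 * int C}) \<times> {..2 * 16 ^ n :: nat}"
  define \<kappa> where "\<kappa> = (\<lambda>e. (z e, f e))"
  have "finite K" by (auto simp: K_def intro!: finite_PiE)
  moreover have "\<kappa> ` E \<subseteq> K"
  proof
    fix k assume "k \<in> \<kappa> ` E"
    then obtain e where e: "e \<in> E" "k = (z e, f e)" by (auto simp: \<kappa>_def)
    then obtain i where "i \<in> e" using E(2) by fastforce
    then obtain j where j: "e = {i, j}" "i \<noteq> j" "i \<in> V" "j \<in> V" using elemE e by blast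
    have "0 \<le> z e k \<and> z e k < 2 * int C" if "k < n" for k
      using p_range[OF j(3) that] p_range[OF j(4) that] z_pair[OF j(2) that] j(1) by simp
    moreover have "z e \<in> extensional {..<n}" by (simp add: z_def)
    ultimately show "k \<in> K" using e f(1) by (simp add: K_def PiE_iff)
  qed
  moreover have "card K \<le> 3 * (32 * C) ^ n"
  proof -
    have "card K = (2 * C) ^ n * Suc (2 * 16 ^ n)"
      by (simp add: K_def card_cartesian_product card_PiE nat_mult_distrib)
    also have "\<dots> \<le> (2 * C) ^ n * (3 * 16 ^ n)"
      by (intro mult_left_mono) (auto simp: Suc_le_eq)
    also have "\<dots> = 3 * (2 * C * 16) ^ n" by (simp only: power_mult_distrib mult_ac)
    finally show ?thesis by (simp add: mult_ac)
  qed
  moreover have "\<forall>k\<in>K. induced_matching E {e \<in> E. \<kappa> e = k}"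
  proof
    fix k
    define M where "M = {e \<in> E. \<kappa> e = k}"
    have M: "e \<in> E" "z e = z e'" "f e = f e'" if "e \<in> M" "e' \<in> M" for e e'
      using that by (auto simp: M_def \<kappa>_def)
    have "disjoint M"
    proof (rule disjointI)
      fix e e' assume "e \<in> M" "e' \<in> M" "e \<noteq> e'"
      then show "e \<inter> e' = {}" using same_sum[of e e'] M by blast
    qed
    moreover have "g \<in> M" if g: "g \<in> E" "g \<subseteq> \<Union>M" for g
    proof -
      obtain a where "a \<in> g" using E(2) g by fastforce
      then obtain b where b: "g = {a, b}" "a \<noteq> b" using elemE g by blast
      obtain e e' where e: "e \<in> M" "a \<in> e" and e': "e' \<in> M" "b \<in> e'" using g b by blast
      obtain a' where a': "e = {a, a'}" "a \<noteq> a'" using elemE e M by metis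
      obtain b' where b': "e' = {b, b'}" "b \<noteq> b'" using elemE e' M by metis
      show ?thesis
      proof (cases "e = e'")
        case True
        then have "e = g" using a' b e' by auto
        then show ?thesis using e by simp
      next
        case False
        have "p a k + p a' k = p b k + p b' k" if "k < n" for k
          using z_pair[OF a'(2) that] z_pair[OF b'(2) that] M(2)[OF e(1) e'(1)] a' b' by simp
        \<comment> \<open>The matching edges \<open>a a'\<close> and \<open>b b'\<close> are the
          diagonals, and the hypothetical edge \<open>a b\<close> is a side. All three squared
          lengths lie within \<open>n\<close> of \<open>\<mu>\<close>, so the other side
          \<open>b a'\<close> is short and the two matching edges conflict.\<close>
        then have "2 * (sqdist n (p a) (p b) + sqdist n (p b) (p a'))
            = sqdist n (p a) (p a') + sqdist n (p b) (p b')"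
          by (rule sqdist_parallelogram)
        then have "real_of_int (2 * (sqdist n (p a) (p b) + sqdist n (p b) (p a')))
            = real_of_int (sqdist n (p a) (p a') + sqdist n (p b) (p b'))"
          by (simp only:)
        then have "2 * (real_of_int (sqdist n (p a) (p b)) + real_of_int (sqdist n (p b) (p a')))
            = real_of_int (sqdist n (p a) (p a')) + real_of_int (sqdist n (p b) (p b'))"
          by (simp only: of_int_add of_int_mult of_int_numeral)
        moreover have "\<bar>real_of_int (sqdist n (p a) (p b)) - \<mu>\<bar> \<le> real n"
          using g(1) b(1) unfolding E_def by (metis distance_graph_pairD)
        moreover have "\<bar>real_of_int (sqdist n (p a) (p a')) - \<mu>\<bar> \<le> real n"
          using M(1)[OF e(1) e(1)] a'(1) unfolding E_def by (metis distance_graph_pairD)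
        moreover have "\<bar>real_of_int (sqdist n (p b) (p b')) - \<mu>\<bar> \<le> real n"
          using M(1)[OF e'(1) e'(1)] b'(1) unfolding E_def by (metis distance_graph_pairD)
        \<comment> \<open>\<open>2 * y = u + v - 2 * x\<close> is at most
          \<open>2 * (\<mu> + d) - 2 * (\<mu> - d) = 4 * d\<close>.\<close>
        moreover have "y \<le> 2 * d"
          if "2 * (x + y) = u + v" "\<bar>x - \<mu>\<bar> \<le> d" "\<bar>u - \<mu>\<bar> \<le> d" "\<bar>v - \<mu>\<bar> \<le> d" for x y u v d :: real
          using that by (auto simp: abs_le_iff)
        ultimately have "real_of_int (sqdist n (p b) (p a')) \<le> 2 * real n" by blast
        then have "close b a'" unfolding close_def by linarith
        then have "R e' e" using M(2)[OF e'(1) e(1)] a' b' by (auto simp: R_def)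
        then have "f e' \<noteq> f e" using f(2) False M(1)[OF e(1) e(1)] M(1)[OF e'(1) e'(1)] by metis
        then show ?thesis using M(3)[OF e(1) e'(1)] by simp
      qed
    qed
    moreover have "M \<subseteq> E" by (auto simp: M_def)
    ultimately have "induced_matching E M" by (auto simp: induced_matching_def induced_edges_def)
    then show "induced_matching E {e \<in> E. \<kappa> e = k}" by (simp add: M_def)
  qed
  ultimately show thesis by (rule that)
qed

text \<open>Chebyshev is applied to pairs of points of the whole grid, with \<open>\<mu>\<close> the
  mean there. The bad pairs from \<open>V\<close> are among them, so \<open>V\<close> may be placed
  arbitrarily.\<close>

lemma distance_graph_missing_edges:
  fixes V :: "'a set" and p :: "'a \<Rightarrow> nat \<Rightarrow> int"
  assumes "finite V" and inj: "inj_on p V" and p: "p ` V \<subseteq> PiE {..<n} (\<lambda>_. {0..<int C})" and "C > 0"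
  obtains \<mu> where "real n * (real (card V choose 2) - real (card (distance_graph V p n \<mu>)))
    \<le> real C ^ 4 * (real C ^ n)\<^sup>2"
proof -
  define B where "B = {0..<int C} \<times> {0..<int C}"
  define f where "f = (\<lambda>(a, b). real_of_int ((a - b)\<^sup>2))"
  define m where "m = (\<Sum>b\<in>B. f b) / card B"
  define E where "E = distance_graph V p n (real n * m)"
  have "finite B" and cB: "card B = C\<^sup>2" by (auto simp: B_def power2_eq_square)
  moreover have "B \<noteq> {}" using \<open>C > 0\<close> by (auto simp: B_def)
  moreover have avg: "m * card B = (\<Sum>b\<in>B. f b)" using cB \<open>C > 0\<close> by (simp add: m_def)
  moreover have f: "0 \<le> f b \<and> f b \<le> (real C)\<^sup>2" if "b \<in> B" for b
  proof -
    obtain x y where b: "b = (x, y)" by force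
    have "\<bar>x - y\<bar> \<le> int C" using that b by (auto simp: B_def)
    then have "(x - y)\<^sup>2 \<le> (int C)\<^sup>2" using abs_le_square_iff[of "x - y" "int C"] by simp
    then have "real_of_int ((x - y)\<^sup>2) \<le> real_of_int ((int C)\<^sup>2)" by (simp only: of_int_le_iff)
    then show ?thesis by (simp add: f_def b)
  qed
  moreover have "\<bar>f b - m\<bar> \<le> (real C)\<^sup>2" if "b \<in> B" for b
  proof -
    have "0 \<le> m * card B" unfolding avg by (intro sum_nonneg) (use f in auto)
    moreover have "m * card B \<le> card B * (real C)\<^sup>2"
      unfolding avg by (intro sum_bounded_above) (use f in auto)
    moreover have "real (card B) > 0" using cB \<open>C > 0\<close> by simp
    ultimately have "0 \<le> m" "m \<le> (real C)\<^sup>2"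
      by (simp_all add: zero_le_mult_iff mult.commute[of m])
    then show ?thesis using f[OF that] by (auto simp: abs_le_iff)
  qed
  ultimately have cheb: "real n * card {w \<in> PiE {..<n} (\<lambda>_. B). \<bar>(\<Sum>k<n. f (w k)) - n * m\<bar> > n}
      \<le> ((real C)\<^sup>2)\<^sup>2 * real (card B) ^ n" (is "real n * real (card ?bad) \<le> _")
    by (intro chebyshev_PiE)
  define P where "P = {(i, j) \<in> V \<times> V. \<not> \<bar>real_of_int (sqdist n (p i) (p j)) - n * m\<bar> \<le> real n}"
  \<comment> \<open>A pair of grid points is read as one sequence of coordinate pairs, a point of
    \<open>B\<close> to the power \<open>n\<close>.\<close>
  define g where "g = (\<lambda>(i, j). \<lambda>k\<in>{..<n}. (p i k, p j k))"
  have pE: "p i \<in> PiE {..<n} (\<lambda>_. {0..<int C})" if "i \<in> V" for i using p that by blast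
  have "card P \<le> card ?bad"
  proof (rule card_inj_on_le[where f = g])
    show "inj_on g P"
    proof (rule inj_onI)
      fix u v assume uv: "u \<in> P" "v \<in> P" "g u = g v"
      obtain i j i' j' where ij: "u = (i, j)" "v = (i', j')" by force
      have V: "i \<in> V" "j \<in> V" "i' \<in> V" "j' \<in> V" using uv ij by (auto simp: P_def)
      have "p i k = p i' k \<and> p j k = p j' k" if "k < n" for k
        using fun_cong[OF uv(3), of k] that ij by (simp add: g_def)
      then have "p i = p i'" "p j = p j'" by (auto intro!: PiE_ext[OF pE pE] V)
      then show "u = v" using inj V ij by (simp add: inj_on_eq_iff)
    qed
    show "g ` P \<subseteq> ?bad"
    proof
      fix w assume "w \<in> g ` P"
      then obtain i j where ij: "(i, j) \<in> P" "w = g (i, j)" by force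
      then have "i \<in> V" "j \<in> V" by (auto simp: P_def)
      then have "w \<in> PiE {..<n} (\<lambda>_. B)" using pE[of i] pE[of j] ij
        by (auto simp: g_def B_def PiE_iff)
      moreover have "(\<Sum>k<n. f (w k)) = real_of_int (sqdist n (p i) (p j))"
        by (simp add: ij g_def f_def sqdist_def)
      ultimately show "w \<in> ?bad" using ij by (simp add: P_def)
    qed
    show "finite ?bad"
      using \<open>finite B\<close> by (intro finite_subset[OF _ finite_PiE[of "{..<n}" "\<lambda>_. B"]]) auto
  qed
  \<comment> \<open>Each missing edge comes from some ordered pair in \<open>P\<close>; counting
    both orders only weakens the bound.\<close>
  moreover have "(card V choose 2) \<le> card E + card P"
  proof -
    have "finite P" using \<open>finite V\<close> by (intro finite_subset[of P "V \<times> V"]) (auto simp: P_def)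
    have "simple_graph V E" unfolding E_def using \<open>finite V\<close> by (rule simple_graph_distance_graph)
    then have "E \<subseteq> Pow V" by (auto simp: simple_graph_def)
    then have "finite E" using \<open>finite V\<close> finite_subset by blast
    have "{e. e \<subseteq> V \<and> card e = 2} \<subseteq> E \<union> (\<lambda>(i, j). {i, j}) ` P"
    proof
      fix e assume "e \<in> {e. e \<subseteq> V \<and> card e = 2}"
      then obtain i j where ij: "e = {i, j}" "i \<noteq> j" "i \<in> V" "j \<in> V" by (auto simp: card_2_iff)
      show "e \<in> E \<union> (\<lambda>(i, j). {i, j}) ` P"
      proof (cases "(i, j) \<in> P")
        case True
        then show ?thesis using ij by force
      next
        case False
        then have "e \<in> E" using ij unfolding E_def distance_graph_def P_def by blast
        then show ?thesis by simp
      qed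
    qed
    then have "card {e. e \<subseteq> V \<and> card e = 2} \<le> card (E \<union> (\<lambda>(i, j). {i, j}) ` P)"
      using \<open>finite E\<close> \<open>finite P\<close> by (intro card_mono) auto
    also have "\<dots> \<le> card E + card ((\<lambda>(i, j). {i, j}) ` P)" by (rule card_Un_le)
    also have "\<dots> \<le> card E + card P" using card_image_le[OF \<open>finite P\<close>] by simp
    finally show ?thesis using \<open>finite V\<close> by (simp add: n_subsets)
  qed
  ultimately have "real (card V choose 2) - real (card E) \<le> card ?bad" by linarith
  then have "real n * (real (card V choose 2) - real (card E)) \<le> real n * card ?bad"
    by (intro mult_left_mono) auto
  also note cheb
  also have "((real C)\<^sup>2)\<^sup>2 * real (card B) ^ n = real C ^ 4 * (real C ^ n)\<^sup>2"
    by (simp add: cB mult.commute flip: power_mult)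
  finally show thesis using that unfolding E_def by blast
qed

subsection \<open>Choice of parameters\<close>

lemma eventually_diagonal:
  fixes P :: "real \<Rightarrow> nat \<Rightarrow> bool"
  assumes "\<And>\<epsilon>. 0 < \<epsilon> \<Longrightarrow> \<epsilon> < 1 \<Longrightarrow> \<forall>\<^sub>F N in sequentially. P \<epsilon> N"
  obtains \<eta> where "\<eta> \<longlonglongrightarrow> 0" "\<forall>\<^sub>F N in sequentially. P (\<eta> N) N"
proof -
  define e where "e = (\<lambda>k::nat. inverse (real (Suc (Suc k))))"
  have "\<forall>\<^sub>F N in sequentially. P (e k) N" for k
    by (rule assms) (auto simp: e_def inverse_less_1_iff)
  then have "\<forall>k. \<exists>T. \<forall>N\<ge>T. P (e k) N" by (simp add: eventually_sequentially)
  then obtain T where T: "\<And>k N. N \<ge> T k \<Longrightarrow> P (e k) N" by metis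
  define S where "S = (\<lambda>N. {k \<in> {..N}. T k \<le> N})"
  define \<kappa> where "\<kappa> = (\<lambda>N. Max (S N))"
  have fin: "finite (S N)" for N by (simp add: S_def)
  have "P (e (\<kappa> N)) N" if "N \<ge> T 0" for N
  proof -
    have "0 \<in> S N" using that by (simp add: S_def)
    then have "\<kappa> N \<in> S N" unfolding \<kappa>_def using fin by (intro Max_in) auto
    then show ?thesis by (intro T) (simp add: S_def)
  qed
  then have "\<forall>\<^sub>F N in sequentially. P (e (\<kappa> N)) N" by (auto simp: eventually_sequentially)
  moreover have "filterlim \<kappa> at_top sequentially"
    unfolding filterlim_at_top eventually_sequentially
  proof (intro allI exI impI)
    fix k N assume "max k (T k) \<le> N"
    then have "k \<in> S N" by (simp add: S_def)
    then show "k \<le> \<kappa> N" unfolding \<kappa>_def using fin by (intro Max_ge)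
  qed
  moreover have "e \<longlonglongrightarrow> 0"
    unfolding e_def using LIMSEQ_inverse_real_of_nat by (rule LIMSEQ_Suc)
  ultimately show thesis using that[of "\<lambda>N. e (\<kappa> N)"] filterlim_compose by blast
qed

text \<open>The missing edges and the edges lost in cutting each number at most
  \<open>\<epsilon> * N\<^sup>2 / 8\<close>, and \<open>N\<^sup>2 / 4\<close> is at most
  \<open>N choose 2\<close>.\<close>

lemma eventually_dense_ruzsa_szemeredi_graph:
  fixes \<epsilon> :: real
  assumes "0 < \<epsilon>" "\<epsilon> < 1"
  shows "\<forall>\<^sub>F N in sequentially. \<exists>(r::nat) (t::nat) (V :: nat set) (E :: nat set set).
    r > 0 \<and> t > 0 \<and> ruzsa_szemeredi_graph r t V E \<and> card V = N \<and>
    real r \<ge> real N powr (1 - \<epsilon>) \<and> real (r * t) \<ge> (1 - \<epsilon>) * real (N choose 2)"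
proof -
  \<comment> \<open>With this \<open>C\<close> the loss \<open>32\<^sup>n\<close> in the number of matchings is beaten by \<open>N powr \<epsilon>\<close>, roughly \<open>64\<^sup>n\<close>.\<close>
  obtain C :: nat where C64: "64 powr (1 / \<epsilon>) \<le> real C" using real_arch_simple by blast
  have "(1::real) < 64 powr (1 / \<epsilon>)" using assms by simp
  then have C: "C \<ge> 2" using C64 by linarith
  have "(64 powr (1 / \<epsilon>)) powr \<epsilon> \<le> real C powr \<epsilon>"
    using C64 assms by (intro powr_mono2) auto
  then have C\<epsilon>: "64 \<le> real C powr \<epsilon>" using assms by (simp add: powr_powr)
  \<comment> \<open>\<open>3072 = 8 * 384\<close>: the 8 is from the error target, and
    \<open>384 = 6 * 64\<close> arises in the bound for \<open>leftover\<close>.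
    \<open>C ^ 6\<close> is what \<open>missing\<close> requires.\<close>
  obtain n0 :: nat where n0: "3072 * real C ^ 6 / \<epsilon> \<le> real n0" using real_arch_simple by blast
  show ?thesis unfolding eventually_sequentially
  proof (rule exI, intro allI impI)
    fix N assume N: "C ^ n0 + 2 \<le> N"
    \<comment> \<open>The least dimension with room for \<open>N\<close> points: minimality gives
      \<open>C ^ n \<le> C * N\<close>, so the grid is too large by at most a factor
      \<open>C\<close>.\<close>
    define n where "n = (LEAST n. N \<le> C ^ n)"
    have "N \<le> 2 ^ N" by (simp add: less_imp_le)
    also have "(2::nat) ^ N \<le> C ^ N" using C by (rule power_mono) simp
    finally have Nn: "N \<le> C ^ n" unfolding n_def by (rule LeastI)
    have "n0 < n"
    proof (rule ccontr)
      assume "\<not> n0 < n"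
      then have "C ^ n \<le> C ^ n0" using C by (intro power_increasing) auto
      then show False using N Nn by simp
    qed
    then obtain m where m: "n = Suc m" by (cases n) auto
    then have "\<not> N \<le> C ^ m" using not_less_Least[of m "\<lambda>n. N \<le> C ^ n"] by (simp flip: n_def)
    then have "C ^ n \<le> C * N" using m by simp
    then have Cn: "real C ^ n \<le> C * real N" by (metis of_nat_le_iff of_nat_mult of_nat_power)
    have nn: "3072 * real C ^ 6 \<le> \<epsilon> * real n"
    proof -
      have "3072 * real C ^ 6 \<le> \<epsilon> * real n0" using n0 assms by (simp add: field_simps)
      also have "\<dots> \<le> \<epsilon> * real n" using \<open>n0 < n\<close> assms by (intro mult_left_mono) auto
      finally show ?thesis .
    qed
    define q where "q = real N powr (1 - \<epsilon>)"
    define r where "r = nat \<lceil>q\<rceil>"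
    have "q \<ge> 1" unfolding q_def using N assms by (intro ge_one_powr_ge_zero) auto
    \<comment> \<open>Since \<open>q \<ge> 1\<close>, rounding up at most doubles it.\<close>
    then have r: "q \<le> real r" "real r \<le> 2 * q" "r > 0" unfolding r_def by linarith+
    have q: "q * 64 ^ m \<le> real N"
    proof -
      have "64 ^ m \<le> (real C powr \<epsilon>) ^ m" using C\<epsilon> by (intro power_mono) auto
      also have "\<dots> = (real C ^ m) powr \<epsilon>" using C by (simp add: powr_power powr_powr mult.commute flip: powr_realpow)
      also have "\<dots> \<le> real N powr \<epsilon>"
        using \<open>\<not> N \<le> C ^ m\<close> assms by (intro powr_mono2) (auto simp flip: of_nat_power)
      finally have "q * 64 ^ m \<le> q * real N powr \<epsilon>" using \<open>q \<ge> 1\<close> by (intro mult_left_mono) auto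
      also have "\<dots> = real N" using N by (simp add: q_def flip: powr_add)
      finally show ?thesis .
    qed
    have "card {..<N} \<le> card (PiE {..<n} (\<lambda>_. {0..<int C}))" using Nn by (simp add: card_PiE)
    then obtain p where p: "inj_on p {..<N}" "p ` {..<N} \<subseteq> PiE {..<n} (\<lambda>_. {0..<int C})"
      using inj_on_iff_card_le[of "{..<N}" "PiE {..<n} (\<lambda>_. {0..<int C})"]
      by (auto simp: finite_PiE)
    obtain \<mu> where \<mu>: "real n * (real (N choose 2) - real (card (distance_graph {..<N} p n \<mu>)))
        \<le> real C ^ 4 * (real C ^ n)\<^sup>2"
      using distance_graph_missing_edges[of "{..<N}" p n C] p C by auto
    define E where "E = distance_graph {..<N} p n \<mu>"
    obtain \<kappa> :: "nat set \<Rightarrow> (nat \<Rightarrow> int) \<times> nat" and K where K: "finite K" "\<kappa> ` E \<subseteq> K"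
      "card K \<le> 3 * (32 * C) ^ n" "\<forall>k\<in>K. induced_matching E {e \<in> E. \<kappa> e = k}"
      unfolding E_def by (rule distance_graph_induced_matchings[OF finite_lessThan p, where \<mu> = \<mu>]) (rule that[unfolded E_def])
    have "simple_graph {..<N} E" unfolding E_def by (simp add: simple_graph_distance_graph)
    then obtain t E' where RS: "ruzsa_szemeredi_graph r t {..<N} E'" and t: "card E \<le> r * t + card K * r"
      using ruzsa_szemeredi_subgraph[OF _ K(1,2) bspec[OF K(4)] r(3)] by blast
    have missing: "real (N choose 2) - card E \<le> \<epsilon> * (real N)\<^sup>2 / 8"
    proof -
      have "real n * (real (N choose 2) - card E) \<le> real C ^ 4 * (real C * real N)\<^sup>2"
        using \<mu> Cn unfolding E_def
        by (elim order_trans) (intro mult_left_mono power_mono, auto)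
      also have "\<dots> = real C ^ 6 * (real N)\<^sup>2" by (simp add: power_mult_distrib flip: power_add mult.assoc)
      also have "\<dots> \<le> (\<epsilon> * real n / 8) * (real N)\<^sup>2"
      proof (rule mult_right_mono)
        have "0 \<le> real C ^ 6" by simp
        then show "real C ^ 6 \<le> \<epsilon> * real n / 8" using nn by linarith
      qed simp
      finally have "real n * (real (N choose 2) - card E) \<le> real n * (\<epsilon> * (real N)\<^sup>2 / 8)"
        by (simp add: mult_ac)
      then show ?thesis using m by simp
    qed
    have leftover: "real (card K * r) \<le> \<epsilon> * (real N)\<^sup>2 / 8"
    proof -
      have "real (card K) \<le> real (3 * (32 * C) ^ n)" using K(3) by (simp only: of_nat_le_iff)
      also have "\<dots> = 3 * 32 ^ n * real C ^ n" by (simp add: power_mult_distrib)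
      also have "\<dots> \<le> 3 * 32 ^ n * (real C * real N)" using Cn by (intro mult_left_mono) auto
      finally have "real (card K) * r \<le> 3 * 32 ^ n * (real C * real N) * (2 * q)"
        using r by (intro mult_mono) auto
      also have "\<dots> = 6 * 32 ^ n * real C * real N * q" by simp
      \<comment> \<open>The extra \<open>2 ^ n\<close> turns \<open>32 ^ n\<close> into
        \<open>64 ^ n = 64 * 64 ^ m\<close>, which \<open>q\<close> can absorb. On the right it
        outgrows the constant \<open>384 * C\<close>.\<close>
      finally have "2 ^ n * (real (card K) * r) \<le> 2 ^ n * (6 * 32 ^ n * real C * real N * q)"
        by (intro mult_left_mono) auto
      also have "\<dots> = 6 * (2 * 32) ^ n * real C * real N * q" by (simp only: power_mult_distrib mult_ac)
      also have "\<dots> = 384 * real C * real N * (q * 64 ^ m)" by (simp add: m)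
      also have "\<dots> \<le> 384 * real C * real N * real N" using q by (intro mult_left_mono) auto
      also have "\<dots> = 384 * real C * (real N)\<^sup>2" by (simp add: power2_eq_square)
      also have "\<dots> \<le> (\<epsilon> * 2 ^ n / 8) * (real N)\<^sup>2"
      proof (rule mult_right_mono)
        have "real C \<le> real C ^ 6" using C by (intro self_le_power) auto
        then have "3072 * real C \<le> \<epsilon> * real n" using nn by linarith
        also have "\<dots> \<le> \<epsilon> * 2 ^ n" using of_nat_less_two_power[of n] assms
          by (intro mult_left_mono less_imp_le) auto
        finally show "384 * real C \<le> \<epsilon> * 2 ^ n / 8" by simp
      qed simp
      finally have "2 ^ n * (real (card K) * r) \<le> 2 ^ n * (\<epsilon> * (real N)\<^sup>2 / 8)"
        by (simp add: mult_ac)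
      then show ?thesis by simp
    qed
    have N2: "(real N)\<^sup>2 / 4 \<le> real (N choose 2)"
    proof -
      have "even (N * (N - 1))" by (cases N) auto
      then have "real (N choose 2) = real N * (real N - 1) / 2"
        using N by (simp add: choose_two real_of_nat_div of_nat_diff)
      moreover have "real N * 2 \<le> real N * real N" using N by (intro mult_left_mono) auto
      ultimately show ?thesis by (simp add: power2_eq_square field_simps)
    qed
    have "real (card E) \<le> real (r * t) + real (card K * r)" using t by (simp only: of_nat_le_iff flip: of_nat_add)
    then have "real (N choose 2) - \<epsilon> * ((real N)\<^sup>2 / 4) \<le> real (r * t)"
      using missing leftover by simp
    moreover have "\<epsilon> * ((real N)\<^sup>2 / 4) \<le> \<epsilon> * real (N choose 2)"
      using N2 assms by (intro mult_left_mono) auto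
    ultimately have rt: "(1 - \<epsilon>) * real (N choose 2) \<le> real (r * t)" by (simp add: algebra_simps)
    have "0 < real N ^ 2 / 4" using N by simp
    then have "0 < real (N choose 2)" using N2 by linarith
    then have "0 < (1 - \<epsilon>) * real (N choose 2)" using assms by (intro mult_pos_pos) auto
    then have "t > 0" using rt by (cases t) auto
    then show "\<exists>(r::nat) (t::nat) (V :: nat set) (E :: nat set set).
      r > 0 \<and> t > 0 \<and> ruzsa_szemeredi_graph r t V E \<and> card V = N \<and>
      real r \<ge> real N powr (1 - \<epsilon>) \<and> real (r * t) \<ge> (1 - \<epsilon>) * real (N choose 2)"
      using r RS rt \<open>t > 0\<close> card_lessThan[of N] unfolding q_def by blast
  qed
qed

theorem mainTheorem1:
  shows "\<exists>\<eta>1 \<eta>2 :: nat \<Rightarrow> real.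
    \<eta>1 \<longlonglongrightarrow> 0 \<and> \<eta>2 \<longlonglongrightarrow> 0 \<and>
    (\<forall>\<^sub>F N in sequentially.
      \<exists>(r::nat) (t::nat) (V :: nat set) (E :: nat set set).
        r > 0 \<and> t > 0 \<and>
        ruzsa_szemeredi_graph r t V E \<and> card V = N \<and>
        real r \<ge> real N powr (1 - \<eta>1 N) \<and>
        real (r * t) \<ge> (1 - \<eta>2 N) * real (N choose 2))"
proof -
  define P where "P = (\<lambda>(\<epsilon>::real) N. \<exists>(r::nat) (t::nat) (V :: nat set) (E :: nat set set).
    r > 0 \<and> t > 0 \<and> ruzsa_szemeredi_graph r t V E \<and> card V = N \<and>
    real r \<ge> real N powr (1 - \<epsilon>) \<and> real (r * t) \<ge> (1 - \<epsilon>) * real (N choose 2))"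
  have "\<forall>\<^sub>F N in sequentially. P \<epsilon> N" if "0 < \<epsilon>" "\<epsilon> < 1" for \<epsilon>
    unfolding P_def using that by (rule eventually_dense_ruzsa_szemeredi_graph)
  then obtain \<eta> where "\<eta> \<longlonglongrightarrow> 0" "\<forall>\<^sub>F N in sequentially. P (\<eta> N) N"
    using eventually_diagonal[of P] by blast
  \<comment> \<open>One \<open>\<eta>\<close> is the witness for both error functions.\<close>
  then show ?thesis unfolding P_def by (intro exI[of _ \<eta>] conjI)
qed

end
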